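(* Let $q=3^n$ with $n\ge 1$, let $a,b\in\mathbb{F}_{q^2}^*$, and let \[ f(X)=X\bigl(1+aX^{q(q-1)}+bX^{2(q-1)}\bigr)\in\mathbb{F}_{q^2}[X]. \] If $f(X)$ is a permutation polynomial of $\mathbb{F}_{q^2}$ (i.e., the map $x\mapsto f(x)$ is a bijection of $\mathbb{F}_{q^2}$), then \[ a^qb^q=a\bigl(b^{q+1}-a^{q+1}\bigr) \] and $1-\left(\frac{b}{a}\right)^{q+1}$ is a square in $\mathbb{F}_q^*$.
   Context: $\mathbb{F}_q$ denotes the finite field with $q$ elements; $\mathbb{F}_q^*$ its multiplicative group. Note $(b/a)^{q+1}\in\mathbb{F}_q$. *)

theory Defs
  imports "HOL-Computational_Algebra.Computational_Algebra" "HOL-Library.Cardinality"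
begin

definition permutation_poly :: "'a::finite_field poly \<Rightarrow> bool" where
  "permutation_poly f \<longleftrightarrow> bij (poly f)"

definition is_subfield :: "'a::field set \<Rightarrow> bool" where
  "is_subfield K \<longleftrightarrow> 0 \<in> K \<and> 1 \<in> K \<and>
     (\<forall>x\<in>K. \<forall>y\<in>K. x + y \<in> K \<and> x * y \<in> K) \<and> (\<forall>x\<in>K. - x \<in> K \<and> inverse x \<in> K)"

text \<open>
  The subfield with \<open>q\<close> elements. In a field with \<open>q\<^sup>2\<close> elements, \<open>q\<close> a prime power, it exists
  and is unique; see \<open>subfield_of_order_unique\<close> and \<open>subfield_of_order_eq\<close> below.
\<close>
definition subfield_of_order :: "nat \<Rightarrow> 'a::finite_field set" where
  "subfield_of_order q = (THE K. is_subfield K \<and> card K = q)"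

lemma is_subfield_power_card:
  fixes K :: "'a::finite_field set"
  assumes K: "is_subfield K" and x: "x \<in> K"
  shows "x ^ card K = x"
proof (cases "x = 0")
  case True
  have "card K \<noteq> 0" using x finite[of K] by (metis card_eq_0_iff empty_iff)
  then show ?thesis using True by (metis gr0I zero_power)
next
  case False
  have "card K \<noteq> 0" using x finite[of K] by (metis card_eq_0_iff empty_iff)
  have "(\<Prod>y\<in>K-{0}. x * y) = (\<Prod>y\<in>K-{0}. y)"
    by (rule prod.reindex_bij_witness[of _ "\<lambda>y. inverse x * y" "\<lambda>y. x * y"])
      (use False x K in \<open>auto simp: is_subfield_def\<close>)
  moreover have "(\<Prod>y\<in>K-{0}. x * y) = x ^ (card K - 1) * \<Prod>(K-{0})"
    using K by (simp add: prod.distrib is_subfield_def)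
  ultimately have "x ^ (card K - 1) = 1" by simp
  then have "x * x ^ (card K - 1) = x" by simp
  then show ?thesis using \<open>card K \<noteq> 0\<close> by (simp flip: power_Suc)
qed

context
  fixes p n q :: nat
  assumes p: "prime p" and n: "n \<ge> 1" and q: "q = p ^ n"
    and card: "card (UNIV :: 'a::finite_field set) = q ^ 2"
begin

lemma char_eq: "CHAR('a) = p"
proof -
  have "(\<Sum>y\<in>UNIV. y + 1) = (\<Sum>y\<in>UNIV. y :: 'a)"
    by (rule sum.reindex_bij_witness[of _ "\<lambda>y. y - 1" "\<lambda>y. y + 1"]) auto
  then have "of_nat CARD('a) = (0 :: 'a)" by (simp add: sum.distrib)
  then have "CHAR('a) dvd p ^ (n * 2)"
    using card q by (simp only: of_nat_eq_0_iff_char_dvd power_mult)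
  then have "CHAR('a) dvd p"
    using prime_dvd_power CHAR_prime[where 'a='a] by blast
  then show ?thesis using p CHAR_prime[where 'a='a] primes_dvd_imp_eq by blast
qed

lemma q_gt_1: "q > 1"
  using p n q by (metis One_nat_def less_le_trans one_less_power prime_gt_1_nat zero_less_one)

lemma frobenius_add: "((x::'a) + y) ^ q = x ^ q + y ^ q"
  by (rule freshmans_dream'[where n = n]) (use p q char_eq in auto)

lemma frobenius_fixed_is_subfield: "is_subfield {x::'a. x ^ q = x}"
proof -
  have "(- x) ^ q = - x" if "x ^ q = x" for x :: 'a
  proof -
    have "(x + - x) ^ q = x ^ q + (- x) ^ q" by (rule frobenius_add)
    then show ?thesis using that q_gt_1 by (simp add: power_0_left add_eq_0_iff)
  qed
  then show ?thesis
    using q_gt_1 by (auto simp: is_subfield_def frobenius_add power_mult_distrib power_inverse)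
qed

lemma card_frobenius_fixed: "card {x::'a. x ^ q = x} = q"
proof -
  let ?P = "monom 1 q - monom 1 1 :: 'a poly"
  have degP: "degree ?P = q"
    using q_gt_1 by (simp only: diff_conv_add_uminus, subst degree_add_eq_left) (auto simp: degree_monom_eq)
  have P0: "?P \<noteq> 0" using degP q_gt_1 by auto
  have rootsP: "{x. poly ?P x = 0} = {x. x ^ q = x}" by (auto simp: poly_monom)
  have le: "card {x::'a. x ^ q = x} \<le> q"
    using card_poly_roots_bound[OF P0] degP rootsP by simp
  let ?G = "monom 1 (q ^ 2) - monom 1 1 :: 'a poly"
  have q2: "q < q ^ 2" using q_gt_1 by (simp add: power2_eq_square)
  have degG: "degree ?G = q ^ 2"
    using q_gt_1 q2 by (simp only: diff_conv_add_uminus, subst degree_add_eq_left) (auto simp: degree_monom_eq)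
  have PG: "?P dvd ?G"
  proof -
    have Pp: "CHAR('a poly) = p" using char_eq by simp
    have "?P ^ q = monom 1 q ^ q - monom 1 1 ^ q"
    proof -
      have "(?P + monom 1 1) ^ q = ?P ^ q + monom 1 1 ^ q"
        by (rule freshmans_dream'[where n = n]) (use p q Pp in auto)
      then show ?thesis by (simp add: algebra_simps)
    qed
    also have "\<dots> = ?G - ?P"
      by (simp add: monom_power power2_eq_square)
    finally have "?G = ?P ^ q + ?P" by simp
    moreover have "?P dvd ?P ^ q" using q_gt_1 by (intro dvd_power) auto
    ultimately show ?thesis by (metis dvd_add dvd_refl)
  qed
  then obtain R where R: "?G = ?P * R" by (auto simp: dvd_def)
  have G0: "?G \<noteq> 0" using degG q2 by (metis degree_0 not_less_zero)
  then have R0: "R \<noteq> 0" using R by auto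
  have degR: "q ^ 2 = q + degree R"
    using R degG degP degree_mult_eq[OF P0 R0] by simp
  have "UNIV = {x. poly ?G x = 0}"
    using finite_field_power_card_eq_same[where 'a='a] card by (auto simp: poly_monom)
  also have "\<dots> = {x. poly ?P x = 0} \<union> {x. poly R x = 0}"
    unfolding R by auto
  finally have "CARD('a) \<le> card {x. poly ?P x = 0} + card {x. poly R x = 0}"
    using card_Un_le by metis
  also have "card {x. poly R x = 0} \<le> degree R" by (rule card_poly_roots_bound[OF R0])
  finally have "q \<le> card {x::'a. x ^ q = x}"
    using degR card rootsP by simp
  with le show ?thesis by simp
qed

lemma subfield_of_order_unique: "\<exists>!K::'a set. is_subfield K \<and> card K = q"
proof (rule ex1I)
  show "is_subfield {x::'a. x ^ q = x} \<and> card {x::'a. x ^ q = x} = q"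
    using frobenius_fixed_is_subfield card_frobenius_fixed by blast
next
  fix K :: "'a set"
  assume K: "is_subfield K \<and> card K = q"
  then have "K \<subseteq> {x. x ^ q = x}" using is_subfield_power_card by blast
  then show "K = {x. x ^ q = x}"
    using K card_frobenius_fixed by (intro card_subset_eq) auto
qed

lemma subfield_of_order_eq: "subfield_of_order q = {x::'a. x ^ q = x}"
  unfolding subfield_of_order_def
  using subfield_of_order_unique frobenius_fixed_is_subfield card_frobenius_fixed
  by (intro the1_equality) auto

end

end

theory Submission
  imports Defs
begin

text \<open>
  Write \<open>a' = a\<^sup>q\<close>, \<open>b' = b\<^sup>q\<close> and let \<open>\<mu>\<close> be the group of \<open>(q + 1)\<close>-th roots of unity.
  Passing to \<open>x = X\<^bsup>q-1\<^esup>\<close>, a permutation polynomial makes the cubic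
  \<open>(a' - y b) x\<^sup>3 + x\<^sup>2 - y x + (b' - y a)\<close> have exactly one root in \<open>\<mu>\<close> for every \<open>y \<in> \<mu>\<close>.
  In characteristic 3 its discriminant is the quartic
  \<open>Q(y) = - b y\<^sup>4 + a' y\<^sup>3 + y\<^sup>2 + a y - b'\<close>, and uniqueness of the root forces
  \<open>Q(y) / y\<^sup>2\<close> to be a nonzero square in the field with \<open>q\<close> elements, that is,
  \<open>Q(y)\<^bsup>(q-1)/2\<^esup> y\<^sup>2 = 1\<close> on \<open>\<mu>\<close>.

  Instead of the Hasse-Weil bound, Stepanov's method is applied: with \<open>\<theta> = y d/dy\<close> and
  \<open>T = y\<^bsup>q+1\<^esup> - 1\<close>, differentiating the divisibility of \<open>Q\<^bsup>(q-1)/2\<^esup> y\<^sup>2 - 1\<close> by \<open>T\<close> twice shows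
  that \<open>T\<close> divides \<open>Q \<theta>\<^sup>2Q + (\<theta>Q)\<^sup>2 + Q\<^sup>2 - Q S\<close> for some \<open>S\<close> of degree at most 2. This has degree
  at most 8, hence vanishes when \<open>q \<ge> 9\<close>, and its coefficients give the relations between \<open>a\<close> and
  \<open>b\<close>. The square root comes from \<open>Q(1)\<close>, which these relations turn into
  \<open>- b (a + a' + a'\<^sup>2/b)\<^sup>2 / a'\<^sup>2\<close>. For \<open>q = 3\<close> the values of \<open>Q\<close> on \<open>\<mu>\<close> force \<open>a = 0\<close>.
\<close>

section \<open>Roots of unity in a finite field\<close>

text \<open>All \<open>e\<close>-th powers of nonzero elements satisfy \<open>y ^ d = 1\<close>,
  which has at most \<open>d\<close> solutions. The fibres of the power map have at most
  \<open>e\<close> elements, so counting forces equality.\<close>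

lemma power_roots_of_unity:
  fixes d e :: nat
  assumes de: "d * e = CARD('a::finite_field) - 1"
  shows "{y::'a. y ^ d = 1} = (\<lambda>x. x ^ e) ` (UNIV - {0})"
    and "card {y::'a. y ^ d = 1} = d"
proof -
  let ?I = "(\<lambda>x::'a. x ^ e) ` (UNIV - {0})"
  have "CARD('a) > 1"
    using card_mono[of UNIV "{0, 1::'a}"] by simp
  then have pos: "d > 0" "e > 0"
    using de by (metis gr0I mult_is_0 zero_less_diff less_irrefl)+
  have roots: "card {x::'a. x ^ k = c} \<le> k" if "k > 0" for c :: 'a and k
  proof -
    let ?p = "monom 1 k - [:c:] :: 'a poly"
    have deg: "degree ?p = k"
      using that by (simp only: diff_conv_add_uminus, subst degree_add_eq_left)
        (auto simp: degree_monom_eq)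
    then have "?p \<noteq> 0" using that by auto
    from card_poly_roots_bound[OF this] deg show ?thesis by (simp add: poly_monom)
  qed
  have sub: "?I \<subseteq> {y. y ^ d = 1}"
  proof clarsimp
    fix x :: 'a assume "x \<noteq> 0"
    have "x * x ^ (CARD('a) - 1) = x"
      using finite_field_power_card_eq_same[of x] \<open>CARD('a) > 1\<close>
      by (simp flip: power_Suc)
    then show "(x ^ e) ^ d = 1"
      using \<open>x \<noteq> 0\<close> by (simp add: mult.commute de flip: power_mult)
  qed
  have "d * e = card (UNIV - {0::'a})" using de by simp
  also have "UNIV - {0::'a} \<subseteq> (\<Union>y\<in>?I. {x. x ^ e = y})" by auto
  then have "card (UNIV - {0::'a}) \<le> card (\<Union>y\<in>?I. {x. x ^ e = y})"
    by (intro card_mono) auto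
  also have "\<dots> \<le> (\<Sum>y\<in>?I. card {x. x ^ e = y})" by (rule card_UN_le) simp
  also have "\<dots> \<le> of_nat (card ?I) * e" by (rule sum_bounded_above) (use roots pos in auto)
  finally have "d \<le> card ?I" using pos by simp
  moreover have "card {y::'a. y ^ d = 1} \<le> d" using roots pos by auto
  moreover have "card ?I \<le> card {y::'a. y ^ d = 1}" using sub by (intro card_mono) auto
  ultimately have eq: "card ?I = card {y::'a. y ^ d = 1}"
    and "card {y::'a. y ^ d = 1} = d" by auto
  then show "card {y::'a. y ^ d = 1} = d" by blast
  show "{y::'a. y ^ d = 1} = ?I" using card_subset_eq[OF _ sub eq] by simp
qed

section \<open>Conjugation and the norm-one group\<close>

locale quadratic_extension_char_3 =
  fixes n q :: nat and a b :: "'a::finite_field"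
  assumes n_pos: "n \<ge> 1" and q_eq: "q = 3 ^ n" and card_eq: "CARD('a) = q ^ 2"
    and a_nz: "a \<noteq> 0" and b_nz: "b \<noteq> 0"
begin

abbreviation a' where "a' \<equiv> a ^ q"
abbreviation b' where "b' \<equiv> b ^ q"

definition unit_circle :: "'a set" where
  "unit_circle = {x. x ^ q * x = 1}"

definition cubic :: "'a \<Rightarrow> 'a \<Rightarrow> 'a" where
  "cubic y x = (a' - y * b) * x ^ 3 + x ^ 2 - y * x + (b' - y * a)"

text \<open>In characteristic 3, \<open>poly quartic y\<close> is the discriminant of \<open>cubic y\<close>.\<close>
definition quartic :: "'a poly" where
  "quartic = [:- b', a, 1, a', - b:]"

lemma char_3: "(3::'a) = 0"
proof -
  have "CHAR('a) = 3"
    by (rule char_eq[OF _ n_pos q_eq card_eq]) simp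
  then have "of_nat 3 = (0::'a)" by (simp add: of_nat_eq_0_iff_char_dvd del: of_nat_numeral)
  then show ?thesis by simp
qed

lemma q_gt_1: "q > 1"
  using n_pos one_less_power[of "3::nat" n] by (simp add: q_eq)

lemma q_odd: "odd q"
  using q_eq by simp

lemma q_square_minus_1: "(q + 1) * (q - 1) = CARD('a) - 1"
  using q_gt_1 by (simp add: card_eq power2_eq_square algebra_simps)

lemma frob_add: "((x::'a) + y) ^ q = x ^ q + y ^ q"
  by (rule frobenius_add[OF _ n_pos q_eq card_eq]) simp

lemma frob_minus: "(- (x::'a)) ^ q = - (x ^ q)"
  using q_odd by (rule power_minus_odd)

lemma frob_diff: "((x::'a) - y) ^ q = x ^ q - y ^ q"
  using frob_add[of x "- y"] by (simp add: frob_minus)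

lemma frob_frob: "((x::'a) ^ q) ^ q = x"
  using finite_field_power_card_eq_same[of x]
  by (simp add: card_eq power2_eq_square flip: power_mult)

lemmas frob = frob_add frob_minus frob_diff frob_frob power_mult_distrib power_divide power_one

lemma unit_circle_nz: "x \<in> unit_circle \<Longrightarrow> x \<noteq> 0"
  by (auto simp: unit_circle_def)

lemma unit_circle_frob: "x \<in> unit_circle \<Longrightarrow> x ^ q = 1 / x"
  using unit_circle_nz[of x] by (simp add: unit_circle_def field_simps)

lemma unit_circle_eq: "unit_circle = {x. x ^ (q + 1) = 1}"
  by (auto simp: unit_circle_def mult.commute)

lemma card_unit_circle: "card unit_circle = q + 1"
  using power_roots_of_unity(2)[OF q_square_minus_1] by (simp only: unit_circle_eq)

lemma unit_circle_cases:
  assumes "x \<in> unit_circle"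
  obtains X where "X \<noteq> 0" "x = X ^ (q - 1)"
  using assms power_roots_of_unity(1)[OF q_square_minus_1] by (auto simp only: unit_circle_eq)

lemma power_q_minus_1_in_unit_circle: "X \<noteq> 0 \<Longrightarrow> X ^ (q - 1) \<in> unit_circle"
  using power_roots_of_unity(1)[OF q_square_minus_1] by (auto simp only: unit_circle_eq)

lemma power_q_minus_1: "(X::'a) ^ (q - 1) * X = X ^ q"
  using q_gt_1 by (simp flip: power_Suc2)

section \<open>The cubic and its discriminant\<close>

lemma poly_quartic:
  "poly quartic y = - b * y ^ 4 + a' * y ^ 3 + y ^ 2 + a * y - b'"
  by (simp add: quartic_def algebra_simps eval_nat_numeral)

text \<open>Expansion about \<open>- y\<close>; the two sides differ by a multiple of 3. Where the
  quartic vanishes, \<open>- y\<close> is thus a multiple root.\<close>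

lemma cubic_eq:
  "cubic y x = (x + y) ^ 2 * (1 + (a' - y * b) * (x + y)) - poly quartic y"
proof -
  have "(x + y) ^ 2 * (1 + (a' - y * b) * (x + y)) - poly quartic y - cubic y x
      = 3 * ((a' - y * b) * y * x ^ 2 + y * x + (a' - y * b) * y ^ 2 * x)"
    by (simp add: poly_quartic cubic_def algebra_simps eval_nat_numeral)
  then show ?thesis by (simp add: char_3)
qed

text \<open>Hence conjugating and reversing the coefficients only scales \<open>cubic y\<close>, so
  its nonzero roots are stable under \<open>x \<mapsto> 1 / x ^ q\<close>.\<close>

lemma leading_coeff_frob:
  assumes "y \<in> unit_circle"
  shows "(a' - y * b) ^ q * y = - (b' - y * a)"
  using unit_circle_nz[OF assms] by (simp add: frob unit_circle_frob[OF assms] field_simps)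

text \<open>If the quartic vanished, the cubic would have the double root \<open>- y\<close> and a
  further root, distinct and both in \<open>unit_circle\<close>.\<close>

lemma poly_quartic_nz:
  assumes y: "y \<in> unit_circle"
    and unique: "\<And>x z. x \<in> unit_circle \<Longrightarrow> z \<in> unit_circle \<Longrightarrow> cubic y x = 0 \<Longrightarrow>
      cubic y z = 0 \<Longrightarrow> x = z"
  shows "poly quartic y \<noteq> 0"
proof
  assume zero: "poly quartic y = 0"
  define A where "A = a' - y * b"
  define D where "D = b' - y * a"
  have y0: "y \<noteq> 0" using y by (rule unit_circle_nz)
  have Aq: "A ^ q * y = - D" using leading_coeff_frob[OF y] by (simp add: A_def D_def)
  have D: "D = y ^ 2 * (1 + A * y)"
    using zero unfolding poly_quartic A_def D_def by (simp add: algebra_simps eval_nat_numeral)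
  have A0: "A \<noteq> 0"
  proof
    assume "A = 0"
    with Aq q_gt_1 have "D = 0" by (simp add: power_0_left)
    with D \<open>A = 0\<close> y0 show False by simp
  qed
  have D0: "D \<noteq> 0" using A0 Aq y0 by auto
  have Aq': "A ^ q = - D / y" using Aq y0 by (simp add: field_simps)
  \<comment> \<open>The zero of the linear factor \<open>1 + A * (x + y)\<close> in
    \<open>cubic_eq\<close>.\<close>
  define z where "z = - 1 / A - y"
  have "z ^ q = y / D - 1 / y"
    using y0 D0 by (simp add: z_def frob unit_circle_frob[OF y] Aq' q_odd)
  then have "z ^ q * z = (y / D - 1 / y) * (- 1 / A - y)" by (simp add: z_def)
  also have "\<dots> = (D - y ^ 2) * (1 + A * y) / (A * y * D)"
    using A0 D0 y0 by (simp add: field_simps eval_nat_numeral)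
  also have "(D - y ^ 2) * (1 + A * y) = A * y * D"
    by (simp add: D algebra_simps eval_nat_numeral)
  also have "A * y * D / (A * y * D) = 1" using A0 D0 y0 by simp
  finally have "z ^ q * z = 1" .
  then have "z \<in> unit_circle" by (simp add: unit_circle_def)
  moreover have "- y \<in> unit_circle" using y by (simp add: unit_circle_def frob)
  moreover have "cubic y z = 0" "cubic y (- y) = 0"
    using zero A0 by (simp_all add: cubic_eq z_def flip: A_def)
  ultimately have "z = - y" using unique by blast
  then show False using A0 by (simp add: z_def)
qed

text \<open>Up to the factor \<open>(x + y) ^ 2\<close>, the quartic is the discriminant
  \<open>E\<close> of the quadratic cofactor of the root \<open>x\<close>. Conjugation determines
  \<open>E ^ m\<close> up to sign, and the wrong sign would put the other two roots in
  \<open>unit_circle\<close>.\<close>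

lemma poly_quartic_power:
  assumes y: "y \<in> unit_circle" and x: "x \<in> unit_circle" and root: "cubic y x = 0"
    and unique: "\<And>z. z \<in> unit_circle \<Longrightarrow> cubic y z = 0 \<Longrightarrow> z = x"
  shows "poly quartic y ^ ((q - 1) div 2) * y ^ 2 = 1"
proof -
  define m where "m = (q - 1) div 2"
  have m: "2 * m = q - 1" using q_odd by (simp add: m_def)
  define A where "A = a' - y * b"
  define D where "D = b' - y * a"
  define E where "E = 1 + A * (x + y)"
  have y0: "y \<noteq> 0" and x0: "x \<noteq> 0" using x y by (simp_all add: unit_circle_nz)
  have Aq: "A ^ q = - D / y"
    using leading_coeff_frob[OF y] y0 by (simp add: A_def D_def field_simps)
  have D: "D = - x * (- y + x + A * x ^ 2)"
    using root by (simp add: cubic_def A_def D_def algebra_simps eval_nat_numeral)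
  have quartic: "poly quartic y = (x + y) ^ 2 * E"
    using root cubic_eq[of y x] by (simp add: E_def A_def)
  have "poly quartic y \<noteq> 0"
    by (rule poly_quartic_nz[OF y]) (metis unique)
  then have E0: "E \<noteq> 0" and xy0: "x + y \<noteq> 0" using quartic by auto
  have Eq: "E ^ q = (x / y) ^ 2 * E"
  proof -
    have "E ^ q = 1 - D / y * (1 / x + 1 / y)"
      by (simp add: E_def frob Aq unit_circle_frob x y)
    also have "\<dots> = (x / y) ^ 2 * E"
      using x0 y0 by (simp add: E_def D field_simps eval_nat_numeral)
    finally show ?thesis .
  qed
  have "(E ^ m) ^ 2 * E = E ^ q"
    using m power_q_minus_1[of E] by (simp add: mult.commute flip: power_mult)
  then have sq: "(E ^ m) ^ 2 = (x / y) ^ 2" using Eq E0 by simp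
  have Em: "E ^ m = x / y"
  proof (rule ccontr)
    assume "E ^ m \<noteq> x / y"
    with sq have Em: "E ^ m = - (x / y)" by (metis power2_eq_iff)
    have "(q + 1) * m * 2 = CARD('a) - 1"
      using q_square_minus_1 m by (simp only: mult.assoc mult.commute[of m])
    from power_roots_of_unity(1)[OF this]
    have squares: "{z::'a. z ^ ((q + 1) * m) = 1} = (\<lambda>x. x ^ 2) ` (UNIV - {0})" .
    have "E ^ ((q + 1) * m) = (- (x / y)) ^ (q + 1)"
      unfolding Em[symmetric] power_mult[symmetric] by (simp only: mult.commute)
    also have "\<dots> = (x / y) ^ (q + 1)" using q_odd by (intro power_minus_even) simp
    also have "\<dots> = 1" using x y by (simp add: unit_circle_eq power_divide del: power_Suc)
    finally obtain s where s: "E = s ^ 2" using squares by blast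
    have s0: "s \<noteq> 0" using s E0 by auto
    have "s ^ (q - 1) = - (x / y)" using Em m s by (simp flip: power_mult)
    then have sq: "s ^ q = - (x / y) * s" using power_q_minus_1[of s] by simp
    \<comment> \<open>A degenerate cubic has \<open>x = y\<close> and \<open>E = 1\<close>, hence
      the right sign.\<close>
    have A0: "A \<noteq> 0"
    proof
      assume "A = 0"
      with Aq y0 q_gt_1 have "D = 0" by (simp add: power_0_left)
      with D \<open>A = 0\<close> x0 have "x = y" by simp
      with \<open>E ^ m \<noteq> x / y\<close> \<open>A = 0\<close> y0 show False by (simp add: E_def)
    qed
    \<comment> \<open>The two other roots of the cubic, by the quadratic formula with \<open>- 1 / 2 = 1\<close>.\<close>
    have root': "(1 + A * x + r) / A = x" if r: "r ^ 2 = E" "r ^ q = - (x / y) * r" for r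
    proof (rule unique)
      \<comment> \<open>The quadratic cofactor is
        \<open>A * z ^ 2 + (1 + A * x) * z + c\<close>.\<close>
      define c where "c = - y + x + A * x ^ 2"
      have Aq': "A ^ q = x * c / y" using Aq D by (simp add: c_def)
      have "A ^ q \<noteq> 0" using A0 by simp
      then have c0: "c \<noteq> 0" using Aq' by auto
      have Ec: "r ^ 2 = (1 + A * x) ^ 2 - A * c"
        unfolding r by (simp add: E_def c_def algebra_simps eval_nat_numeral)
      define z where "z = (1 + A * x + r) / A"
      have "z ^ q = (1 + A ^ q / x - x / y * r) / A ^ q"
        by (simp add: z_def frob unit_circle_frob[OF x] r(2))
      also have "1 + A ^ q / x - x / y * r = x / y * (1 + A * x - r)"
        using x0 y0 unfolding Aq' by (simp add: c_def field_simps eval_nat_numeral)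
      finally have "z ^ q * z = x / y * (1 + A * x - r) / A ^ q * ((1 + A * x + r) / A)"
        by (simp add: z_def)
      also have "\<dots> = x / y * ((1 + A * x) ^ 2 - r ^ 2) / (A ^ q * A)"
        unfolding power2_eq_square square_diff_square_factored by (simp add: mult_ac)
      also have "\<dots> = 1" using A0 c0 x0 y0 by (simp add: Ec Aq')
      finally show "(1 + A * x + r) / A \<in> unit_circle" by (simp add: unit_circle_def z_def)
      have Az: "A * z = 1 + A * x + r" using A0 by (simp add: z_def)
      have "cubic y z = cubic y z - cubic y x" using root by simp
      also have "\<dots> = (z - x) * (A * z ^ 2 + (1 + A * x) * z + c)"
        by (simp add: cubic_def A_def c_def algebra_simps eval_nat_numeral)
      finally have cubic_z: "cubic y z = (z - x) * (A * z ^ 2 + (1 + A * x) * z + c)" .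
      have "A * cubic y z = (z - x) * ((A * z) ^ 2 + (1 + A * x) * (A * z) + A * c)"
        unfolding cubic_z by (simp add: algebra_simps eval_nat_numeral)
      also have "(A * z) ^ 2 + (1 + A * x) * (A * z) + A * c
          = 3 * ((1 + A * x) ^ 2 + (1 + A * x) * r) + (r ^ 2 - ((1 + A * x) ^ 2 - A * c))"
        unfolding Az by (simp add: algebra_simps eval_nat_numeral)
      also have "\<dots> = 0" using Ec char_3 by simp
      finally show "cubic y ((1 + A * x + r) / A) = 0" using A0 by (simp add: z_def)
    qed
    \<comment> \<open>Both square roots of \<open>E\<close> qualify as \<open>r\<close>, so
      uniqueness identifies the two remaining roots.\<close>
    have "(1 + A * x + s) / A = (1 + A * x + - s) / A"
      using root'[of s] root'[of "- s"] s sq by (simp add: frob)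
    then have "s = - s" using A0 by simp
    then have "2 * s = 0" by simp
    moreover have "2 * s = 3 * s - s" by simp
    ultimately show False using s0 char_3 by simp
  qed
  \<comment> \<open>The square factor contributes \<open>1 / (x * y)\<close>, which times
    \<open>E ^ m = x / y\<close> leaves \<open>1 / y ^ 2\<close>.\<close>
  have "(x + y) ^ q = (x + y) / (x * y)"
    using x0 y0 by (simp add: frob unit_circle_frob x y field_simps)
  then have "(x + y) ^ (q - 1) = 1 / (x * y)"
    using power_q_minus_1[of "x + y"] xy0 by (simp add: nonzero_eq_divide_eq[symmetric])
  then have "((x + y) ^ 2) ^ m = 1 / (x * y)" using m by (simp flip: power_mult)
  then show ?thesis
    using x0 y0 unfolding quartic m_def[symmetric] power_mult_distrib[of _ E] Em
    by (simp add: power2_eq_square)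
qed

section \<open>Stepanov's method on the unit circle\<close>

definition circle_poly :: "'a poly" where
  "circle_poly = monom 1 (q + 1) - 1"

lemma degree_circle_poly: "degree circle_poly = q + 1"
  unfolding circle_poly_def by (simp only: diff_conv_add_uminus, subst degree_add_eq_left)
    (auto simp: degree_monom_eq)

lemma circle_poly_nz: "circle_poly \<noteq> 0"
  using degree_circle_poly by auto

lemma circle_poly_mult_degree:
  assumes "degree (circle_poly * p) \<le> q + 1 + k"
  shows "degree p \<le> k"
  using assms circle_poly_nz by (cases "p = 0") (auto simp: degree_mult_eq degree_circle_poly)

lemma circle_poly_mult_eq_0:
  assumes "degree (circle_poly * p) < q + 1"
  shows "p = 0"
  using assms circle_poly_nz by (cases "p = 0") (auto simp: degree_mult_eq degree_circle_poly)

text \<open>The remainder has \<open>q + 1\<close> zeros, more than its degree allows unless it is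
  zero.\<close>

lemma circle_poly_dvd:
  assumes "\<And>y. y \<in> unit_circle \<Longrightarrow> poly p y = 0"
  shows "circle_poly dvd p"
proof -
  let ?r = "p mod circle_poly"
  have "poly ?r y = 0" if "y \<in> unit_circle" for y
  proof -
    have "poly circle_poly y = 0"
      using that by (simp add: circle_poly_def poly_monom unit_circle_eq)
    moreover have "poly p y = poly (p div circle_poly) y * poly circle_poly y + poly ?r y"
      by (simp flip: poly_mult poly_add)
    ultimately show ?thesis using assms[OF that] by simp
  qed
  then have "unit_circle \<subseteq> {y. poly ?r y = 0}" by blast
  then have "q + 1 \<le> card {y. poly ?r y = 0}"
    using card_unit_circle by (metis card_mono finite)
  moreover have "?r = 0 \<or> degree ?r < q + 1"
    using degree_mod_less[OF circle_poly_nz] by (simp add: degree_circle_poly)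
  ultimately have "?r = 0" using card_poly_roots_bound[of ?r] by fastforce
  then show ?thesis by (simp add: dvd_eq_mod_eq_0)
qed

lemma degree_quartic: "degree quartic = 4"
  using b_nz by (simp add: quartic_def)

text \<open>The Euler operator keeps exponents in place, unlike \<open>pderiv\<close>, and sends
  \<open>circle_poly\<close> to 1 modulo itself.\<close>

definition theta :: "'a poly \<Rightarrow> 'a poly" where
  "theta p = [:0, 1:] * pderiv p"

lemma theta_add: "theta (p + r) = theta p + theta r"
  by (simp add: theta_def pderiv_add algebra_simps)

lemma theta_diff: "theta (p - r) = theta p - theta r"
  by (simp add: theta_def pderiv_diff algebra_simps)

lemma theta_mult: "theta (p * r) = theta p * r + p * theta r"
  by (simp add: theta_def pderiv_mult algebra_simps)

lemma degree_theta: "degree (theta p) \<le> degree p"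
proof (rule degree_le, safe)
  fix k assume "degree p < k"
  then show "coeff (theta p) k = 0"
    by (cases k) (simp_all add: theta_def coeff_pderiv coeff_eq_0)
qed

lemma poly_char_3: "(3::'a poly) = 0"
  by (simp add: numeral_poly char_3)

lemma two_eq: "(2::'a) = - 1"
proof -
  have "(2::'a) = 3 - 1" by simp
  then show ?thesis by (simp add: char_3)
qed

lemma of_nat_q: "of_nat q = (0::'a)"
  using n_pos by (simp add: q_eq char_3)

lemma theta_circle_poly: "theta circle_poly = circle_poly + 1"
proof -
  have "pderiv circle_poly = monom (of_nat (q + 1)) q"
    by (simp add: circle_poly_def pderiv_diff pderiv_monom)
  then show ?thesis by (simp add: theta_def of_nat_q circle_poly_def monom_Suc)
qed

lemma theta_quartic: "theta quartic = [:0, a, - 1, 0, - b:]"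
proof -
  have "(4::'a) = 3 + 1" by simp
  then show ?thesis
    by (simp add: theta_def quartic_def pderiv_pCons two_eq char_3)
qed

lemma theta_theta_quartic: "theta (theta quartic) = [:0, a, 1, 0, - b:]"
proof -
  have "(4::'a) = 3 + 1" by simp
  then show ?thesis
    unfolding theta_quartic by (simp add: theta_def pderiv_pCons two_eq char_3)
qed

text \<open>The right-hand side is the part of \<open>quartic\<^sup>2\<close> with exponents divisible by 3.\<close>
lemma stepanov_identity:
  assumes vals: "\<And>y. y \<in> unit_circle \<Longrightarrow> poly quartic y ^ ((q - 1) div 2) * y ^ 2 = 1"
    and q: "q \<ge> 9"
  obtains s0 s1 s2 where "quartic * [:s0, s1, s2:]
    = quartic * theta (theta quartic) + quartic ^ 2 + theta quartic ^ 2"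
proof -
  define m where "m = (q - 1) div 2"
  have m: "2 * m = q - 1" using q_odd by (simp add: m_def)
  \<comment> \<open>In the field \<open>m\<close> equals 1, so differentiating \<open>Q ^ m\<close>
    brings in no numerical factor.\<close>
  have "2 * of_nat m = (of_nat q - 1 :: 'a)"
    using m q_gt_1 by (metis of_nat_mult of_nat_numeral of_nat_diff less_imp_le of_nat_1)
  then have of_nat_m: "of_nat m = (1::'a)" by (simp add: of_nat_q two_eq)
  define Q where "Q = quartic"
  define T where "T = circle_poly"
  define U where "U = theta Q"
  define V where "V = theta U"
  define P where "P = Q ^ m"
  define X2 :: "'a poly" where "X2 = [:0, 0, 1:]"
  define W where "W = P * X2 - 1"
  have "poly W y = 0" if "y \<in> unit_circle" for y
    using vals[OF that] by (simp add: W_def P_def Q_def X2_def m_def power2_eq_square algebra_simps)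
  then have "T dvd W" unfolding T_def by (rule circle_poly_dvd)
  then obtain R where R: "W = T * R" by (auto simp: dvd_def)
  have "degree P \<le> 4 * m"
    unfolding P_def Q_def by (rule order_trans[OF degree_power_le]) (simp add: degree_quartic)
  then have "degree (P * X2) \<le> 4 * m + 2"
    by (intro order_trans[OF degree_mult_le]) (simp add: X2_def)
  then have "degree W \<le> 4 * m + 2"
    unfolding W_def by (intro degree_diff_le) auto
  then have degR: "degree R \<le> q - 1"
    using m q circle_poly_mult_degree[of R "q - 1"] unfolding R T_def by simp
  \<comment> \<open>The factor \<open>Q\<close> restores the full power \<open>P\<close>, which
    \<open>W\<close> can then absorb through \<open>P * X2 = W + 1\<close>.\<close>
  have QP: "Q * theta P = U * P"
  proof -
    have "m > 0" using m q by simp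
    then have "Q * Q ^ (m - 1) = P" by (simp add: P_def flip: power_Suc)
    moreover have "theta P = Q ^ (m - 1) * U"
      by (simp add: P_def U_def theta_def pderiv_power of_nat_m)
    ultimately show ?thesis by (metis mult.assoc mult.commute)
  qed
  have "theta X2 = - X2" by (simp add: X2_def theta_def pderiv_pCons two_eq)
  moreover have "theta 1 = 0" by (simp add: theta_def)
  ultimately have "theta W = theta P * X2 - P * X2"
    by (simp add: W_def theta_diff theta_mult)
  then have "Q * theta W = (Q * theta P) * X2 - Q * (P * X2)"
    by (simp add: right_diff_distrib mult.assoc)
  also have "\<dots> = (U - Q) * (P * X2)" unfolding QP by (simp add: left_diff_distrib mult.assoc)
  finally have thW: "Q * theta W = (U - Q) * (W + 1)" by (simp add: W_def)
  have thT: "theta T = T + 1" unfolding T_def by (rule theta_circle_poly)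
  \<comment> \<open>Substituting \<open>W = T * R\<close> in \<open>thW\<close> and collecting the
    multiples of \<open>T\<close> gives this quotient.\<close>
  define S where "S = (U - Q) * R - Q * R - Q * theta R"
  have QR: "Q * R - (U - Q) = T * S"
    using thW unfolding R theta_mult thT S_def by (simp add: algebra_simps)
  have degQ: "degree Q = 4" by (simp add: Q_def degree_quartic)
  then have degU: "degree U \<le> 4" unfolding U_def using degree_theta[of Q] by simp
  then have degV: "degree V \<le> 4" unfolding V_def using degree_theta[of U] by simp
  have "degree (T * S) \<le> q + 3" unfolding QR[symmetric]
    using degQ degU degR degree_mult_le[of Q R] q_gt_1 by (intro degree_diff_le) auto
  then have degS: "degree S \<le> 2" using circle_poly_mult_degree[of S 2] unfolding T_def by simp
  have E2: "Q * W = T * (U - Q) + T * (T * S)"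
  proof -
    have "Q * W = T * (Q * R)" by (simp add: R mult.left_commute)
    also have "Q * R = U - Q + T * S" using QR by (simp add: diff_eq_eq add.commute)
    finally show ?thesis by (simp only: distrib_left)
  qed
  \<comment> \<open>The second differentiation yields another equation linear in
    \<open>W\<close>.\<close>
  have "theta (Q * W) = theta (T * (U - Q) + T * (T * S))" using E2 by simp
  then have E1: "U * W + (U - Q) * (W + 1)
      = (T + 1) * (U - Q) + T * (V - U) + 2 * (T * (T + 1) * S) + T * T * theta S"
    unfolding theta_add theta_mult theta_diff thT thW[symmetric]
    by (simp add: U_def V_def algebra_simps)
  define L where "L = 2 * (U * S) - Q * theta S"
  define K where "K = Q * V + Q ^ 2 + U ^ 2 - Q * S"
  \<comment> \<open>\<open>Q\<close> times \<open>E1\<close> minus \<open>2 * U - Q\<close> times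
    \<open>E2\<close> eliminates \<open>W\<close>; the multiple of 3 vanishes afterwards.\<close>
  have "T * (T * L - (K + 3 * (U * Q - Q ^ 2 - U ^ 2 + Q * T * S + Q * S)))
      = Q * (U * W + (U - Q) * (W + 1)
          - ((T + 1) * (U - Q) + T * (V - U) + 2 * (T * (T + 1) * S) + T * T * theta S))
        - (2 * U - Q) * (Q * W - (T * (U - Q) + T * (T * S)))"
    unfolding L_def K_def by (simp add: algebra_simps power2_eq_square)
  also have "\<dots> = 0" unfolding E1 E2 by simp
  finally have TL: "T * L = K" using circle_poly_nz by (simp add: poly_char_3 T_def)
  have "degree K \<le> 8" unfolding K_def
    using degree_mult_le[of Q V] degree_power_le[of Q 2] degree_power_le[of U 2]
      degree_mult_le[of Q S] degQ degU degV degS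
    by (intro degree_diff_le degree_add_le) auto
  \<comment> \<open>Here \<open>q \<ge> 9\<close> enters: \<open>T\<close> has degree at least 10,
    while \<open>K\<close> has degree at most 8.\<close>
  then have "L = 0" using q circle_poly_mult_eq_0[of L] unfolding TL[symmetric] T_def by simp
  then have "K = 0" using TL by simp
  moreover have "S = [:coeff S 0, coeff S 1, coeff S 2:]"
    using degS by (intro poly_eqI)
      (auto simp: coeff_pCons coeff_eq_0 eval_nat_numeral split: nat.split)
  ultimately show ?thesis
    using that unfolding K_def V_def U_def Q_def by (metis eq_iff_diff_eq_0)
qed

section \<open>Relations between the coefficients and the square root\<close>

text \<open>In \<open>stepanov_identity\<close>, degrees 0 and 1 give \<open>s0 = - b'\<close> and
  \<open>s1 = - a\<close>; degrees 3 to 6 then give the four relations for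
  \<open>s = s2\<close>.\<close>

lemma coeff_relations:
  assumes vals: "\<And>y. y \<in> unit_circle \<Longrightarrow> poly quartic y ^ ((q - 1) div 2) * y ^ 2 = 1"
    and q: "q \<ge> 9"
  obtains s where "s = a * a' - b * b'" "a' * s = - (a * b)" "a * s = - (a' * b')"
    "b * s = - b - a' ^ 2"
proof -
  obtain s0 s1 s2 where eq: "quartic * [:s0, s1, s2:]
    = quartic * theta (theta quartic) + quartic ^ 2 + theta quartic ^ 2"
    using stepanov_identity[OF assms] by metis
  have dbl: "x + x = - x" "x + (x + z) = - x + z" for x z :: 'a
    using arg_cong[OF two_eq, of "\<lambda>c. c * x"] by (simp_all add: algebra_simps)
  have "quartic * theta (theta quartic) + quartic ^ 2 + theta quartic ^ 2
      = [:b' ^ 2, 0, 0, a' * b' - a, 0, 0, a' ^ 2 + b:]"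
    unfolding theta_theta_quartic unfolding theta_quartic unfolding quartic_def
    by (simp add: power2_eq_square algebra_simps dbl)
  with eq have eqs: "- b' * s0 = b' ^ 2" "a * s0 - b' * s1 = 0"
    "a' * s0 + s1 + a * s2 = a' * b' - a" "- b * s0 + a' * s1 + s2 = 0" "- b * s1 + a' * s2 = 0"
    "- b * s2 = a' ^ 2 + b"
    by (simp_all add: quartic_def algebra_simps)
  have b'0: "b' \<noteq> 0" using b_nz by simp
  have s0: "s0 = - b'"
  proof -
    have "b' * - s0 = b' * b'" using eqs(1) by (simp add: power2_eq_square)
    then have "- s0 = b'" using b'0 by (metis mult_left_cancel)
    then show ?thesis by (metis minus_minus)
  qed
  have s1: "s1 = - a"
  proof -
    have "b' * s1 = b' * - a" using eqs(2) by (simp add: s0 algebra_simps)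
    then show ?thesis using b'0 by (metis mult_left_cancel)
  qed
  show ?thesis
  proof (rule that[of s2])
    show "s2 = a * a' - b * b'" using eqs(4) by (simp add: s0 s1 algebra_simps)
    show "a' * s2 = - (a * b)"
      using eqs(5) by (simp add: s1 eq_neg_iff_add_eq_0 mult.commute add.commute)
    show "b * s2 = - b - a' ^ 2"
      using arg_cong[OF eqs(6), of uminus] by (simp add: algebra_simps)
    show "a * s2 = - (a' * b')"
      using eqs(3) by (simp add: s0 s1 algebra_simps dbl)
  qed
qed

text \<open>For \<open>q = 3\<close>, reducing the hypothesis by \<open>y ^ 4 = 1\<close> leaves a
  polynomial of degree 3 that \<open>circle_poly\<close>, of degree 4, would have to divide.\<close>

lemma q_neq_3:
  assumes vals: "\<And>y. y \<in> unit_circle \<Longrightarrow> poly quartic y ^ ((q - 1) div 2) * y ^ 2 = 1"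
  shows "q \<noteq> 3"
proof
  assume q3: "q = 3"
  let ?p = "[:0, a', - (b + b'), a:]"
  have "poly ?p y = 0" if y: "y \<in> unit_circle" for y
  proof -
    have y4: "y ^ 4 = 1" using y unfolding unit_circle_eq by (simp add: q3 eval_nat_numeral)
    have "poly ?p y = poly quartic y * y ^ 2 - 1 + (y ^ 4 - 1) * (b * y ^ 2 - a' * y - 1)"
      by (simp add: poly_quartic algebra_simps eval_nat_numeral)
    then show ?thesis using vals[OF y] by (simp add: y4 q3)
  qed
  then have "circle_poly dvd ?p" by (rule circle_poly_dvd)
  then have "degree circle_poly \<le> degree ?p" using a_nz by (intro dvd_imp_degree_le) auto
  then show False using a_nz degree_circle_poly q3 by simp
qed

lemma relation_and_square_if_quartic_power:
  assumes vals: "\<And>y. y \<in> unit_circle \<Longrightarrow> poly quartic y ^ ((q - 1) div 2) * y ^ 2 = 1"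
  shows "a' * b' = a * (b ^ (q + 1) - a ^ (q + 1)) \<and>
    (\<exists>c. c \<noteq> 0 \<and> c ^ q = c \<and> 1 - (b / a) ^ (q + 1) = c ^ 2)"
proof -
  have "n \<noteq> 1" using q_neq_3[OF vals] q_eq by auto
  then have "n \<ge> 2" using n_pos by simp
  then have "q \<ge> 9" unfolding q_eq using power_increasing[of 2 n "3::nat"] by simp
  with vals obtain s where s: "s = a * a' - b * b'" "a' * s = - (a * b)" "a * s = - (a' * b')"
    "b * s = - b - a' ^ 2"
    by (rule coeff_relations)
  have first: "a' * b' = a * (b ^ (q + 1) - a ^ (q + 1))"
    using s(3) unfolding s(1) by (simp add: algebra_simps)
  have a'0: "a' \<noteq> 0" and b'0: "b' \<noteq> 0" using a_nz b_nz by simp_all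
  \<comment> \<open>That is, \<open>b * a ^ 2\<close> is fixed by Frobenius, which makes
    \<open>V\<close> fixed as well.\<close>
  have conj: "b * a ^ 2 = b' * a' ^ 2"
  proof -
    \<comment> \<open>Variables replace \<open>a'\<close> and \<open>b'\<close>, so that
      \<open>algebra\<close> sees no symbolic exponent.\<close>
    have "b * a ^ 2 = d * c ^ 2" if "c * s = - (a * b)" "a * s = - (c * d)" for c d
      using that by algebra
    from this[OF s(2,3)] show ?thesis .
  qed
  define V where "V = a + a' + a' ^ 2 / b"
  have "V ^ q = a' + a + a ^ 2 / b'"
    by (simp add: V_def frob power2_eq_square)
  also have "a ^ 2 / b' = a' ^ 2 / b" using conj b_nz b'0 by (simp add: field_simps)
  finally have Vq: "V ^ q = V" by (simp add: V_def)
  define r where "r = poly quartic 1"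
  have r: "r ^ ((q - 1) div 2) = 1"
    using vals[of 1] by (simp add: r_def unit_circle_def)
  have rV: "r * a' ^ 2 = - b * V ^ 2"
  proof -
    have bV: "b * V = a * b + a' * b + a' ^ 2" using b_nz by (simp add: V_def field_simps)
    have "c * b + c ^ 3 = b ^ 2 * a" if "c * s = - (a * b)" "b * s = - b - c ^ 2" for c
      using that by algebra
    from this[OF s(2,4)] have rel: "a' * b + a' ^ 3 = b ^ 2 * a" .
    have "b * (r * a' ^ 2) + (b * V) ^ 2
        = 3 * (a * a' ^ 2 * b + a' ^ 3 * b + b ^ 2 * a * a')
          + a' * (a' * b + a' ^ 3 - b ^ 2 * a) + b * (b * a ^ 2 - b' * a' ^ 2)"
      unfolding bV r_def poly_quartic by (simp add: algebra_simps eval_nat_numeral)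
    then have "b * (r * a' ^ 2) + (b * V) ^ 2 = 0" by (simp only: rel conj char_3) simp
    then have "b * (r * a' ^ 2 + b * V ^ 2) = 0"
      by (simp add: algebra_simps power2_eq_square)
    then show ?thesis using b_nz by (simp add: add_eq_0_iff)
  qed
  have r0: "r \<noteq> 0"
  proof
    assume "r = 0"
    with r have "(q - 1) div 2 = 0" by (simp add: power_0_left split: if_splits)
    with \<open>q \<ge> 9\<close> show False by simp
  qed
  then have V0: "V \<noteq> 0" using rV a'0 by auto
  have "1 - (b / a) ^ (q + 1) = s / (a * a')"
    using a_nz a'0 s(1) by (simp add: power_divide field_simps)
  also have "\<dots> = - b / a' ^ 2"
    using s(2) a_nz a'0 by (simp add: field_simps power2_eq_square)
  also have "\<dots> = r / V ^ 2" using rV V0 a'0 by (simp add: field_simps)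
  finally have t: "1 - (b / a) ^ (q + 1) = r / V ^ 2" .
  obtain c where c: "r = c ^ 2" "c \<noteq> 0"
  proof -
    have "(q + 1) * ((q - 1) div 2) * 2 = CARD('a) - 1"
      using q_square_minus_1 q_odd by (simp add: mult.assoc)
    from power_roots_of_unity(1)[OF this] have "{z::'a. z ^ ((q + 1) * ((q - 1) div 2)) = 1}
      = (\<lambda>x. x ^ 2) ` (UNIV - {0})" .
    moreover have "r ^ ((q + 1) * ((q - 1) div 2)) = 1"
      unfolding mult.commute[of "q + 1"] power_mult r by simp
    ultimately show ?thesis using that by blast
  qed
  \<comment> \<open>The root \<open>c\<close> was found in the large field; the value of
    \<open>r ^ ((q - 1) div 2)\<close> places it in the subfield.\<close>
  have "c ^ (q - 1) = 1" using r q_odd unfolding c(1) by (simp flip: power_mult)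
  then have "c ^ q = c" using power_q_minus_1[of c] by simp
  then have "(c / V) ^ q = c / V" by (simp add: Vq power_divide)
  moreover have "c / V \<noteq> 0" using c V0 by simp
  moreover have "1 - (b / a) ^ (q + 1) = (c / V) ^ 2" unfolding t c(1) by (simp add: power_divide)
  ultimately show ?thesis using first by blast
qed

section \<open>From the permutation to the cubic\<close>

text \<open>With \<open>x = X ^ (q - 1)\<close>, the power \<open>F X ^ (q - 1)\<close> depends only
  on \<open>x\<close>, and for \<open>F X \<noteq> 0\<close> the cubic says that it equals
  \<open>y\<close>. Surjectivity gives a root. For uniqueness, two preimages have values with ratio
  \<open>c\<close> in the subfield, and \<open>F\<close> commutes with scaling by \<open>c\<close>,
  so injectivity makes the preimages proportional.\<close>

lemma ex1_cubic_root:
  assumes bij: "bij (\<lambda>x. x * (1 + a * x ^ (q * (q - 1)) + b * x ^ (2 * (q - 1))))"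
    and y: "y \<in> unit_circle"
  shows "\<exists>!x. x \<in> unit_circle \<and> cubic y x = 0"
proof -
  define h where "h x = 1 + a * x ^ q + b * x ^ 2" for x
  define F where "F X = X * h (X ^ (q - 1))" for X
  have "F = (\<lambda>x. x * (1 + a * x ^ (q * (q - 1)) + b * x ^ (2 * (q - 1))))"
    by (simp add: F_def h_def fun_eq_iff mult.commute flip: power_mult)
  with bij have F: "bij F" by simp
  have cubic: "cubic y x = x * (x * h x ^ q - y * h x)" if x: "x \<in> unit_circle" for x
  proof -
    have "h x ^ q = 1 + a' * x + b' / x ^ 2"
      by (simp add: h_def frob power2_eq_square unit_circle_frob[OF x])
    then show ?thesis
      using unit_circle_nz[OF x]
      by (simp add: h_def cubic_def unit_circle_frob[OF x] field_simps eval_nat_numeral)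
  qed
  \<comment> \<open>The exponent \<open>q\<close> instead of \<open>q - 1\<close> also covers
    \<open>F X = 0\<close>, which injectivity excludes later.\<close>
  have frob_F: "F X ^ q = y * F X" if "X \<noteq> 0" "cubic y (X ^ (q - 1)) = 0" for X
  proof -
    let ?x = "X ^ (q - 1)"
    have x: "?x \<in> unit_circle" using that(1) by (rule power_q_minus_1_in_unit_circle)
    have "?x * h ?x ^ q = y * h ?x"
      using cubic[OF x] that unit_circle_nz[OF x] by simp
    moreover have "F X ^ q = X * (?x * h ?x ^ q)"
      unfolding F_def power_mult_distrib power_q_minus_1[of X, symmetric] by simp
    ultimately show ?thesis by (simp add: F_def)
  qed
  show ?thesis
  proof (rule ex_ex1I, goal_cases)
    case 1
    obtain Y where Y: "Y \<noteq> 0" "y = Y ^ (q - 1)" using y by (rule unit_circle_cases)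
    obtain X where X: "F X = Y" using F by (metis bij_pointE)
    then have X0: "X \<noteq> 0" using Y by (auto simp: F_def)
    let ?x = "X ^ (q - 1)"
    have x: "?x \<in> unit_circle" using X0 by (rule power_q_minus_1_in_unit_circle)
    have "y = ?x * h ?x ^ (q - 1)"
      unfolding Y(2) X[symmetric] F_def power_mult_distrib ..
    then have "y * h ?x = ?x * h ?x ^ q" using power_q_minus_1[of "h ?x"] by (simp add: mult.assoc)
    then show ?case using cubic[OF x] x by auto
  next
    case (2 x z)
    then obtain X Z where X: "X \<noteq> 0" "x = X ^ (q - 1)" and Z: "Z \<noteq> 0" "z = Z ^ (q - 1)"
      by (metis unit_circle_cases)
    have "F 0 = 0" by (simp add: F_def)
    then have F0: "F X \<noteq> 0" "F Z \<noteq> 0"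
      using F X Z by (metis bij_is_inj injD)+
    define c where "c = F X / F Z"
    have c0: "c \<noteq> 0" using F0 by (simp add: c_def)
    have "c ^ q = c"
      using 2 X Z F0 frob_F unit_circle_nz[OF y] by (simp add: c_def power_divide)
    then have c1: "c ^ (q - 1) = 1" using power_q_minus_1[of c] c0 by simp
    then have "F (c * Z) = c * F Z" by (simp add: F_def power_mult_distrib)
    also have "\<dots> = F X" using F0 by (simp add: c_def)
    finally have "c * Z = X" using F by (metis bij_is_inj injD)
    then show ?case using X Z c1 by (auto simp: power_mult_distrib)
  qed
qed

end

theorem theorem3p1:
  fixes n q :: nat and a b :: "'a::finite_field" and f :: "'a poly"
  assumes "n \<ge> 1" and "q = 3 ^ n" and "CARD('a) = q ^ 2"
    and "a \<noteq> 0" and "b \<noteq> 0"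
    and "f = monom 1 1 * (1 + monom a (q * (q - 1)) + monom b (2 * (q - 1)))"
    and "permutation_poly f"
  shows "a ^ q * b ^ q = a * (b ^ (q + 1) - a ^ (q + 1)) \<and>
    (\<exists>c \<in> subfield_of_order q - {0}. 1 - (b / a) ^ (q + 1) = c ^ 2)"
proof -
  interpret quadratic_extension_char_3 n q a b
    by unfold_locales (use assms in auto)
  have "poly f = (\<lambda>x. x * (1 + a * x ^ (q * (q - 1)) + b * x ^ (2 * (q - 1))))"
    by (simp add: assms(6) poly_monom fun_eq_iff)
  then have bij: "bij (\<lambda>x. x * (1 + a * x ^ (q * (q - 1)) + b * x ^ (2 * (q - 1))))"
    using assms(7) by (simp add: permutation_poly_def)
  have "poly quartic y ^ ((q - 1) div 2) * y ^ 2 = 1" if y: "y \<in> unit_circle" for y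
  proof -
    obtain x where "x \<in> unit_circle" "cubic y x = 0"
      "\<And>z. z \<in> unit_circle \<Longrightarrow> cubic y z = 0 \<Longrightarrow> z = x"
      using ex1_cubic_root[OF bij y] by blast
    with y show ?thesis by (rule poly_quartic_power)
  qed
  moreover have "subfield_of_order q = {x::'a. x ^ q = x}"
    by (rule subfield_of_order_eq[OF _ assms(1-3)]) simp
  ultimately show ?thesis using relation_and_square_if_quartic_power by auto
qed

end
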